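(* Let $\lambda<0$, $n=2$, $R>0$, and suppose $v_0(R)<0$. Then there exists $t_c\in(0,\infty)$ such that $X(t_c,R)=0$ or $\Gamma(t_c,R)=0$ if and only if $A(R)=0$ or one of the following conditions holds (all quantities evaluated at $R$): (1) $\rho_0=0$ (i.e. $\partial_rA=0$); (2) $\partial_rA>0$ and one of: (a) $\partial_r(v_0^2)\ge A/R+(\partial_rA)\log(Re^{C/A})$; (b) $A/R\le\partial_r(v_0^2)<A/R+(\partial_rA)\log(Re^{C/A})$ and $$\frac1{|v_0|}+\frac12\int_R^{\exp\left(-\frac{\partial_rC}{\partial_rA}\right)}\frac{\partial_rC+\partial_rA\log y}{(C+A\log y)^{3/2}}dy\le\max(0,2\partial_rt_* );$$ (c) $\partial_r(v_0^2)<A/R$ and $$\frac1{|v_0|}+\frac12\int_R^{\exp\left(-\frac{\partial_rC}{\partial_rA}\right)}\frac{\partial_rC+\partial_rA\log y}{(C+A\log y)^{3/2}}dy\le2\partial_rt_*,$$ where $$t_*=t_*(R):=\frac R{A(R)^{1/2}e^{v_0(R)^2/A(R)}}\int_1^{e^{v_0(R)^2/A(R)}}\frac{dz}{\sqrt{\log z}}.$$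
   Context: Data: $\rho_0\in C([0,\infty))$, $\rho_0\ge0$; $v_0\in C([0,\infty))\cap C^1((0,\infty))$ with $v_0(0)=0$. Put $m_0(r)=\int_0^r\rho_0(s)s\,ds$, $A(r)=2|\lambda|m_0(r)$, $C(r)=v_0(r)^2-A(r)\log r$. For each $R>0$, $X(t,R)$ (the characteristic curve of the two-dimensional radial Euler-Poisson system) is the solution of $$X''(t,R)=-\frac{\lambda m_0(R)}{X(t,R)},\quad X'(0,R)=v_0(R),\quad X(0,R)=R,$$ where primes on $X$ are $t$-derivatives, continued up to the first time (if any) at which $X$ reaches $0$; and $\Gamma(t,R)=\partial_RX(t,R)$. A necessary and sufficient condition for the existence of $t_c\in(0,\infty)$ with $X(t_c,R)=0$ or $\Gamma(t_c,R)=0$ is called a pointwise condition for finite-time breakdown (PCFB) at $R$. Condition (2) need only be read when $A(R)>0$. *)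

theory Defs
  imports "HOL-Analysis.Analysis"
begin

definition m0 :: "(real \<Rightarrow> real) \<Rightarrow> real \<Rightarrow> real" where
  "m0 \<rho>\<^sub>0 r = integral {0..r} (\<lambda>s. \<rho>\<^sub>0 s * s)"

definition A_fun :: "real \<Rightarrow> (real \<Rightarrow> real) \<Rightarrow> real \<Rightarrow> real" where
  "A_fun lam \<rho>\<^sub>0 r = 2 * \<bar>lam\<bar> * m0 \<rho>\<^sub>0 r"

definition C_fun :: "real \<Rightarrow> (real \<Rightarrow> real) \<Rightarrow> (real \<Rightarrow> real) \<Rightarrow> real \<Rightarrow> real" where
  "C_fun lam \<rho>\<^sub>0 v\<^sub>0 r = (v\<^sub>0 r)\<^sup>2 - A_fun lam \<rho>\<^sub>0 r * ln r"

text \<open>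
  A characteristic is represented by a total function of which only the values on its
  lifespan matter: the closed interval up to the first zero, or all of \<open>[0,\<infinity>)\<close>.
\<close>

definition lifespan :: "(real \<Rightarrow> real) \<Rightarrow> real set" where
  "lifespan x = {t. 0 \<le> t \<and> (\<forall>s. 0 \<le> s \<and> s < t \<longrightarrow> 0 < x s)}"

text \<open>
  The derivatives are taken within \<open>{0..}\<close>, not within the lifespan, so that \<open>x\<close> stays
  positive just after any time at which it is positive: the solution can only stop
  at a zero. At a zero \<open>x\<close> is only required to be continuous from the left.
\<close>

definition is_characteristic ::
    "real \<Rightarrow> (real \<Rightarrow> real) \<Rightarrow> (real \<Rightarrow> real) \<Rightarrow> real \<Rightarrow> (real \<Rightarrow> real) \<Rightarrow> bool" where
  "is_characteristic lam \<rho>\<^sub>0 v\<^sub>0 R x \<longleftrightarrow>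
     x 0 = R \<and> continuous_on (lifespan x) x \<and>
     (\<exists>x'. x' 0 = v\<^sub>0 R \<and>
       (\<forall>t\<in>lifespan x. 0 < x t \<longrightarrow>
          (x has_real_derivative x' t) (at t within {0..}) \<and>
          (x' has_real_derivative (- (lam * m0 \<rho>\<^sub>0 R) / x t)) (at t within {0..})))"

text \<open>
  \<open>X t r\<close> is the position at time \<open>t\<close> of the characteristic starting at \<open>r\<close>. For the \<open>C\<^sup>1\<close> data
  considered, \<open>X t\<close> is differentiable at \<open>R\<close> as long as \<open>X\<close> is positive on \<open>[0,t]\<close> along
  the characteristic from \<open>R\<close>.
\<close>

definition Gamma_flow :: "(real \<Rightarrow> real \<Rightarrow> real) \<Rightarrow> real \<Rightarrow> real \<Rightarrow> real" where
  "Gamma_flow X t R = deriv (\<lambda>r. X t r) R"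

definition t_star :: "real \<Rightarrow> (real \<Rightarrow> real) \<Rightarrow> (real \<Rightarrow> real) \<Rightarrow> real \<Rightarrow> real" where
  "t_star lam \<rho>\<^sub>0 v\<^sub>0 R =
     R / (sqrt (A_fun lam \<rho>\<^sub>0 R) * exp ((v\<^sub>0 R)\<^sup>2 / A_fun lam \<rho>\<^sub>0 R)) *
     integral {1..exp ((v\<^sub>0 R)\<^sup>2 / A_fun lam \<rho>\<^sub>0 R)} (\<lambda>z. 1 / sqrt (ln z))"

text \<open>
  The left-hand side of the integral inequalities. The integral is oriented: its upper
  limit may lie below \<open>R\<close>.
\<close>

definition I_fun :: "real \<Rightarrow> (real \<Rightarrow> real) \<Rightarrow> (real \<Rightarrow> real) \<Rightarrow> real \<Rightarrow> real" where
  "I_fun lam \<rho>\<^sub>0 v\<^sub>0 R =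
     1 / \<bar>v\<^sub>0 R\<bar> + 1 / 2 *
       (LBINT y = ereal R .. ereal (exp (- (deriv (C_fun lam \<rho>\<^sub>0 v\<^sub>0) R / deriv (A_fun lam \<rho>\<^sub>0) R))).
          (deriv (C_fun lam \<rho>\<^sub>0 v\<^sub>0) R + deriv (A_fun lam \<rho>\<^sub>0) R * ln y) /
          (C_fun lam \<rho>\<^sub>0 v\<^sub>0 R + A_fun lam \<rho>\<^sub>0 R * ln y) powr (3 / 2))"

end

theory Submission
  imports Defs
begin

text \<open>
  Let \<open>G(u) = 2 \<integral>\<^sub>0\<^sup>u exp(w\<^sup>2) dw\<close>. If \<open>A(R) > 0\<close>, conservation of energy gives \<open>X = m exp(U\<^sup>2)\<close> with
  \<open>U = X' / \<surd>A\<close> and \<open>m = R exp(- v\<^sub>0\<^sup>2 / A)\<close>, and \<open>G(U)\<close> turns out to be affine in time: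
  \<open>G(U) = G(p) + k t\<close> with \<open>p = v\<^sub>0 / \<surd>A\<close>, \<open>k = \<surd>A / m\<close>. In particular \<open>X\<close> never vanishes, and
  \<open>t\<^sub>* = - G(p) / k\<close> is the time at which \<open>U = 0\<close>. Differentiating in \<open>R\<close> yields
  \<open>\<Gamma> = \<mu> exp(U\<^sup>2) + U (q G(U) - s)\<close> where \<open>\<mu> = m'\<close>, \<open>q = m k' / k\<close> and \<open>s = \<surd>A t\<^sub>*'\<close>,
  so one has to decide whether this function of \<open>U\<close> vanishes on \<open>(p, \<infinity>)\<close>. At \<open>U = p\<close> it is \<open>1\<close>, and
  at \<open>U = 0\<close> it is \<open>\<mu>\<close>; the condition \<open>\<mu> \<le> 0\<close> is (a). If \<open>\<mu> > 0\<close>, then \<open>\<Gamma> = U (h(U) - s)\<close> with the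
  odd function \<open>h(u) = \<mu> exp(u\<^sup>2) / u + q G(u)\<close>. On \<open>(0, \<infinity>)\<close> it is unbounded below if \<open>\<partial>\<^sub>rA = 0\<close>, and
  otherwise has its minimum at the \<open>w\<close> corresponding to \<open>X = exp(- \<partial>\<^sub>rC / \<partial>\<^sub>rA)\<close>. The integrand
  of the theorem is, up to a factor, the derivative of \<open>h\<close> in the variable \<open>X\<close>, and its
  integral inequalities compare \<open>h(w)\<close> with \<open>s\<close> (zero of \<open>\<Gamma>\<close> after \<open>t\<^sub>*\<close>) and \<open>- s\<close> (before \<open>t\<^sub>*\<close>).
\<close>

section \<open>The function \<open>G\<close> and its inverse\<close>

text \<open>Up to the factor sqrt(pi) this is the imaginary error function. The oriented integral
  gives it its odd values at negative arguments, which occur because the characteristics start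
  inwards.\<close>

definition G :: "real \<Rightarrow> real" where
  "G u = (LBINT w=ereal 0..ereal u. 2 * exp (w\<^sup>2))"

lemma G_deriv: "(G has_real_derivative 2 * exp (u\<^sup>2)) (at u within S)"
proof -
  \<comment> \<open>The fundamental theorem works within a compact interval; this one contains both
    0 and \<open>u\<close> in its interior, so the derivative is two-sided.\<close>
  have "((\<lambda>u. LBINT w=ereal 0..ereal u. 2 * exp (w\<^sup>2)) has_vector_derivative 2 * exp (u\<^sup>2))
      (at u within {- \<bar>u\<bar> - 1..\<bar>u\<bar> + 1})"
    by (intro interval_integral_FTC2 continuous_intros) auto
  then have "(G has_real_derivative 2 * exp (u\<^sup>2)) (at u within {- \<bar>u\<bar> - 1..\<bar>u\<bar> + 1})"
    by (simp add: has_real_derivative_iff_has_vector_derivative G_def[abs_def])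
  moreover have "at u within {- \<bar>u\<bar> - 1..\<bar>u\<bar> + 1} = at u"
    by (intro at_within_interior) auto
  ultimately show ?thesis
    using DERIV_subset by fastforce
qed

lemma G_0 [simp]: "G 0 = 0"
  by (simp add: G_def)

lemmas G_deriv_chain [derivative_intros] = G_deriv[THEN DERIV_chain2]

lemma continuous_on_G [continuous_intros]:
  assumes "continuous_on S f"
  shows "continuous_on S (\<lambda>x. G (f x))"
proof -
  have "continuous_on UNIV G"
    by (intro DERIV_continuous_on[OF G_deriv])
  then show ?thesis
    using assms by (metis continuous_on_compose2 subset_UNIV)
qed

lemma G_minus: "G (- u) = - G u"
proof -
  have "((\<lambda>u. G (- u) + G u) has_real_derivative 0) (at x)" for x
    by (auto intro!: derivative_eq_intros)
  from DERIV_isconst_all[rule_format, OF this, of u 0] show ?thesis by simp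
qed

lemma G_strict_mono: "strict_mono G"
proof (rule strict_monoI)
  fix a b :: real
  assume "a < b"
  then show "G a < G b"
    by (rule DERIV_pos_imp_increasing) (metis G_deriv exp_gt_zero mult_pos_pos zero_less_numeral)
qed

text \<open>The integrand is at least 2. Together with oddness this bound makes \<open>G\<close>
  surjective.\<close>

lemma G_ge: "u \<ge> 0 \<Longrightarrow> G u \<ge> 2 * u"
proof -
  assume "u \<ge> 0"
  have "G 0 - 2 * 0 \<le> G u - 2 * u"
    using \<open>u \<ge> 0\<close>
    by (rule DERIV_nonneg_imp_nondecreasing) (auto intro!: exI derivative_eq_intros)
  then show ?thesis by simp
qed

lemma G_surj: "\<exists>u. G u = y"
proof -
  have "G (- \<bar>y\<bar>) \<le> y" "y \<le> G \<bar>y\<bar>"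
    using G_ge[of "\<bar>y\<bar>"] by (auto simp: G_minus)
  then show ?thesis
    using IVT'[of G "- \<bar>y\<bar>" y "\<bar>y\<bar>"] continuous_on_G[OF continuous_on_id] by auto
qed

definition Ginv :: "real \<Rightarrow> real" where
  "Ginv = inv G"

lemma G_Ginv [simp]: "G (Ginv y) = y"
  using G_surj by (metis Ginv_def f_inv_into_f rangeI)

lemma Ginv_G [simp]: "Ginv (G u) = u"
  by (metis G_Ginv G_strict_mono strict_mono_eq)

lemma Ginv_deriv: "(Ginv has_real_derivative inverse (2 * exp ((Ginv y)\<^sup>2))) (at y within S)"
proof -
  have "isCont Ginv (G (Ginv y))"
    by (rule isCont_inverse_function[where d = 1])
      (auto intro: DERIV_isCont[OF G_deriv])
  then have "(Ginv has_real_derivative inverse (2 * exp ((Ginv y)\<^sup>2))) (at y)"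
    by (intro DERIV_inverse_function[OF G_deriv, where a = "y - 1" and b = "y + 1"]) auto
  then show ?thesis
    using has_field_derivative_at_within by blast
qed

lemmas Ginv_deriv_chain [derivative_intros] = Ginv_deriv[THEN DERIV_chain2]

text \<open>Substitute z = exp(w^2). The integrand is singular at z = 1, but the antiderivative
  \<open>G (sqrt (ln z))\<close> is continuous up to that endpoint, so the fundamental theorem with
  interior derivatives applies.\<close>

lemma integral_inverse_sqrt_ln:
  assumes "0 \<le> u"
  shows "integral {1..exp (u\<^sup>2)} (\<lambda>z. 1 / sqrt (ln z)) = G u"
proof -
  have "((\<lambda>z. 1 / sqrt (ln z)) has_integral G (sqrt (ln (exp (u\<^sup>2)))) - G (sqrt (ln 1))) {1..exp (u\<^sup>2)}"
  proof (rule fundamental_theorem_of_calculus_interior)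
    show "continuous_on {1..exp (u\<^sup>2)} (\<lambda>z. G (sqrt (ln z)))"
      by (intro continuous_intros) auto
    fix z assume z: "z \<in> {1<..<exp (u\<^sup>2)}"
    then have "ln z > 0" by auto
    then have "((\<lambda>z. G (sqrt (ln z))) has_real_derivative 1 / sqrt (ln z)) (at z)"
      using z by (auto intro!: derivative_eq_intros simp: field_simps)
    then show "((\<lambda>z. G (sqrt (ln z))) has_vector_derivative 1 / sqrt (ln z)) (at z)"
      by (simp add: has_real_derivative_iff_has_vector_derivative)
  qed auto
  then show ?thesis
    using assms by (simp add: integral_unique)
qed

section \<open>Characteristics and their dependence on the starting point\<close>

text \<open>Otherwise let \<open>T\<close> be the infimum of the times with nonpositive position. It
  lies in the lifespan, so \<open>x T\<close> is positive; the derivative within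
  \<open>{0..}\<close> gives continuity from the right, so \<open>x\<close> stays positive beyond
  \<open>T\<close>, contradicting the choice of \<open>T\<close>.\<close>

lemma lifespan_noncollapsing:
  assumes "is_characteristic lam \<rho> v r x"
    and pos: "\<And>t. t \<in> lifespan x \<Longrightarrow> 0 < x t"
  shows "lifespan x = {0..}"
proof (rule ccontr)
  assume "lifespan x \<noteq> {0..}"
  define S where "S = {s. 0 \<le> s \<and> x s \<le> 0}"
  have "S \<noteq> {}"
    using \<open>lifespan x \<noteq> {0..}\<close> unfolding S_def lifespan_def by fastforce
  have bdd: "bdd_below S"
    unfolding S_def by (rule bdd_belowI[where m = 0]) auto
  define T where "T = Inf S"
  have T0: "0 \<le> T"
    unfolding T_def by (rule cInf_greatest[OF \<open>S \<noteq> {}\<close>]) (auto simp: S_def)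
  have T: "T \<in> lifespan x"
    unfolding lifespan_def using T0 cInf_lower[OF _ bdd] unfolding T_def S_def
    by (force simp: not_le[symmetric])
  then have "0 < x T" by (rule pos)
  then have "continuous (at T within {0..}) x"
    using assms(1) T unfolding is_characteristic_def
    by (meson DERIV_continuous)
  then have "eventually (\<lambda>s. 0 < x s) (at T within {0..})"
    using \<open>0 < x T\<close> unfolding continuous_within by (rule order_tendstoD(1))
  then obtain d where d: "d > 0" "\<And>s. s \<ge> 0 \<Longrightarrow> s \<noteq> T \<Longrightarrow> dist s T < d \<Longrightarrow> 0 < x s"
    unfolding eventually_at by auto
  obtain s where s: "s \<in> S" "s < T + d"
    using cInf_lessD[OF \<open>S \<noteq> {}\<close>, of "T + d"] d(1) by (auto simp: T_def)
  moreover have "T \<le> s"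
    unfolding T_def by (rule cInf_lower[OF s(1) bdd])
  ultimately show False
    using d(2)[of s] \<open>0 < x T\<close> by (cases "s = T") (auto simp: S_def dist_real_def)
qed

text \<open>Left continuity carries a bound to the end of the lifespan, where \<open>x\<close> might
  vanish and the differential equation says nothing.\<close>

lemma lifespan_lower_bound:
  assumes "continuous_on (lifespan x) x" "t \<in> lifespan x" "0 < t"
    and ge: "\<And>s. 0 \<le> s \<Longrightarrow> s < t \<Longrightarrow> c \<le> x s"
  shows "c \<le> x t"
proof -
  have "(x \<longlongrightarrow> x t) (at t within lifespan x)"
    using assms(1,2) unfolding continuous_on_def by blast
  then have "(x \<longlongrightarrow> x t) (at t within {0..<t})"
    by (rule tendsto_within_subset) (use assms(2) in \<open>auto simp: lifespan_def\<close>)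
  moreover have "eventually (\<lambda>s. c \<le> x s) (at t within {0..<t})"
    unfolding eventually_at using ge by (intro exI[of _ 1]) auto
  moreover have "at t within {0..<t} \<noteq> bot"
    using \<open>0 < t\<close> by (simp add: trivial_limit_within islimpt_Ico)
  ultimately show ?thesis
    by (rule tendsto_lowerbound)
qed

text \<open>Without mass there is no force. If no zero were reached, the lifespan would be all of
  \<open>{0..}\<close> and the motion uniform with negative velocity, which does reach the
  origin.\<close>

lemma characteristic_free:
  assumes "is_characteristic lam \<rho> v r x" "m0 \<rho> r = 0" "0 < r" "v r < 0"
  shows "\<exists>t>0. t \<in> lifespan x \<and> x t = 0"
proof (rule ccontr)
  assume no: "\<not> ?thesis"
  obtain x' where x: "x 0 = r" "continuous_on (lifespan x) x" "x' 0 = v r"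
    and der: "\<And>t. t \<in> lifespan x \<Longrightarrow> 0 < x t \<Longrightarrow>
          (x has_real_derivative x' t) (at t within {0..}) \<and>
          (x' has_real_derivative 0) (at t within {0..})"
    using assms(1,2) unfolding is_characteristic_def by auto
  have pos: "0 < x t" if t: "t \<in> lifespan x" for t
  proof (cases "t = 0")
    case False
    then have "t > 0" using t by (auto simp: lifespan_def)
    then have "0 \<le> x t"
      using t by (intro lifespan_lower_bound[OF x(2) t]) (auto simp: lifespan_def intro: less_imp_le)
    then show ?thesis
      using no \<open>t > 0\<close> t by force
  qed (use x(1) assms(3) in auto)
  have ls: "lifespan x = {0..}"
    by (rule lifespan_noncollapsing[OF assms(1) pos])
  have "\<exists>c. \<forall>t\<in>{0..}. x' t = c"
    by (rule has_field_derivative_zero_constant) (use der pos ls in auto)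
  then have x': "x' t = v r" if "t \<ge> 0" for t
    using that x(3) by (metis atLeast_iff order_refl)
  have "\<exists>c. \<forall>t\<in>{0..}. x t - v r * t = c"
    by (rule has_field_derivative_zero_constant)
      (use der pos ls x' in \<open>auto intro!: derivative_eq_intros\<close>)
  then have "x t - v r * t = r" if "t \<ge> 0" for t
    using that x(1) by (metis atLeast_iff order_refl mult_zero_right diff_zero)
  \<comment> \<open>This is the time at which uniform motion from \<open>r\<close> with velocity
    \<open>v r\<close> arrives at 0.\<close>
  from this[of "r / - v r"] have "x (r / - v r) = 0"
    using assms(3,4) by (simp add: field_simps)
  moreover have "0 \<le> r / - v r"
    using assms(3,4) by (intro divide_nonneg_pos) auto
  ultimately show False
    using pos[of "r / - v r"] ls by auto
qed

text \<open>Conservation of energy keeps \<open>x\<close> above \<open>m > 0\<close>, which rules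
  out a collapse. With U = x' / sqrt a the equation becomes U' = sqrt a / (2 x), and x = m exp(U^2)
  then makes the derivative of G(U) the constant sqrt a / m.\<close>

lemma characteristic_explicit:
  assumes ch: "is_characteristic lam \<rho> v r x" and "lam < 0" "0 < r"
    and a: "a = A_fun lam \<rho> r" "0 < a"
    and m: "m = r * exp (- ((v r)\<^sup>2 / a))"
  shows "lifespan x = {0..}"
    and "\<And>t. 0 \<le> t \<Longrightarrow> x t = m * exp ((Ginv (G (v r / sqrt a) + sqrt a / m * t))\<^sup>2)"
    and "\<And>t. 0 \<le> t \<Longrightarrow> 0 < x t"
proof -
  have lam: "- (lam * m0 \<rho> r) = a / 2"
    using \<open>lam < 0\<close> a by (simp add: A_fun_def)
  have "0 < m" using m assms by simp
  obtain x' where x: "x 0 = r" "continuous_on (lifespan x) x" "x' 0 = v r"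
    and der: "\<And>t. t \<in> lifespan x \<Longrightarrow> 0 < x t \<Longrightarrow>
          (x has_real_derivative x' t) (at t within {0..}) \<and>
          (x' has_real_derivative a / 2 / x t) (at t within {0..})"
    using ch unfolding is_characteristic_def lam by auto
  \<comment> \<open>The interval is left open because the identity is used twice: on
    \<open>{0..<t}\<close> to prove positivity at \<open>t\<close>, and on \<open>{0..}\<close> once
    the lifespan is known.\<close>
  have energy: "x t = m * exp ((x' t / sqrt a)\<^sup>2)"
    if I: "convex I" "0 \<in> I" "I \<subseteq> {0..}" "I \<subseteq> lifespan x" "\<And>t. t \<in> I \<Longrightarrow> 0 < x t" "t \<in> I" for I t
  proof -
    have "\<exists>c. \<forall>t\<in>I. (x' t)\<^sup>2 - a * ln (x t) = c"
    proof (rule has_field_derivative_zero_constant[OF I(1)])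
      fix t assume t: "t \<in> I"
      then have "(x has_real_derivative x' t) (at t within I)"
        "(x' has_real_derivative a / 2 / x t) (at t within I)"
        using der I by (meson DERIV_subset subsetD)+
      with I(5)[OF t] show "((\<lambda>t. (x' t)\<^sup>2 - a * ln (x t)) has_real_derivative 0) (at t within I)"
        by (auto intro!: derivative_eq_intros simp: field_simps)
    qed
    then have "(x' t)\<^sup>2 - a * ln (x t) = (v r)\<^sup>2 - a * ln r"
      using I(2,6) x by metis
    then have "ln (x t) = ln r - (v r)\<^sup>2 / a + (x' t)\<^sup>2 / a"
      using a by (simp add: field_simps)
    then have "x t = exp (ln r - (v r)\<^sup>2 / a + (x' t)\<^sup>2 / a)"
      using I(5)[OF I(6)] by (metis exp_ln)
    also have "\<dots> = r * exp (- ((v r)\<^sup>2 / a)) * exp ((x' t)\<^sup>2 / a)"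
      using \<open>0 < r\<close> by (simp only: exp_add diff_conv_add_uminus exp_ln)
    finally show ?thesis
      using a(2) by (simp add: m power_divide)
  qed
  have pos: "0 < x t" if t: "t \<in> lifespan x" for t
  proof (cases "t = 0")
    case False
    then have "t > 0" using t by (auto simp: lifespan_def)
    have "m \<le> x s" if "0 \<le> s" "s < t" for s
    proof -
      have "x s = m * exp ((x' s / sqrt a)\<^sup>2)"
        using t that by (intro energy[of "{0..<t}"]) (auto simp: lifespan_def)
      then show ?thesis
        using \<open>0 < m\<close> by simp
    qed
    then have "m \<le> x t"
      by (rule lifespan_lower_bound[OF x(2) t \<open>t > 0\<close>])
    then show ?thesis
      using \<open>0 < m\<close> by simp
  qed (use x(1) assms(3) in auto)
  show ls: "lifespan x = {0..}"
    by (rule lifespan_noncollapsing[OF ch pos])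
  show "0 < x t" if "0 \<le> t" for t
    using pos ls that by simp
  have en: "x t = m * exp ((x' t / sqrt a)\<^sup>2)" if "0 \<le> t" for t
    using ls pos that by (intro energy[of "{0..}"]) auto
  have "\<exists>c. \<forall>t\<in>{0..}. G (x' t / sqrt a) - sqrt a / m * t = c"
  proof (rule has_field_derivative_zero_constant)
    fix t :: real assume t: "t \<in> {0..}"
    have "((\<lambda>t. G (x' t / sqrt a) - sqrt a / m * t) has_real_derivative
        2 * exp ((x' t / sqrt a)\<^sup>2) * (a / 2 / x t / sqrt a) - sqrt a / m) (at t within {0..})"
      using der[of t] t ls pos
      by (intro DERIV_diff DERIV_chain2[OF G_deriv] DERIV_cdivide DERIV_cmult_Id) auto
    moreover have "2 * exp ((x' t / sqrt a)\<^sup>2) * (a / 2 / x t / sqrt a) - sqrt a / m = 0"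
      using en[of t] t a \<open>0 < m\<close> by (simp add: field_simps)
    ultimately show "((\<lambda>t. G (x' t / sqrt a) - sqrt a / m * t) has_real_derivative 0) (at t within {0..})"
      by simp
  qed auto
  then have "G (x' t / sqrt a) - sqrt a / m * t = G (x' 0 / sqrt a) - sqrt a / m * 0" if "0 \<le> t" for t
    using that by (metis atLeast_iff order_refl)
  then have "G (x' t / sqrt a) = G (v r / sqrt a) + sqrt a / m * t" if "0 \<le> t" for t
    using that x(3) by (simp add: algebra_simps)
  then have "x' t / sqrt a = Ginv (G (v r / sqrt a) + sqrt a / m * t)" if "0 \<le> t" for t
    using that by (metis Ginv_G)
  then show "x t = m * exp ((Ginv (G (v r / sqrt a) + sqrt a / m * t))\<^sup>2)" if "0 \<le> t" for t
    using en that by metis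
qed

text \<open>After the chain rule, \<open>t\<close> is eliminated through G(u) = G(p) + k t, so that
  \<open>\<Gamma>\<close> depends on time through \<open>u\<close> alone.\<close>

lemma explicit_flow_deriv:
  fixes m k p :: "real \<Rightarrow> real" and R t :: real
  assumes d [derivative_intros]: "(m has_real_derivative m') (at R)" "(k has_real_derivative k') (at R)"
      "(p has_real_derivative p') (at R)"
    and "k R \<noteq> 0"
  defines "u \<equiv> Ginv (G (p R) + k R * t)"
  shows "((\<lambda>r. m r * exp ((Ginv (G (p r) + k r * t))\<^sup>2)) has_real_derivative
     m' * exp (u\<^sup>2) + u * (m R * k' / k R * G u - m R * (G (p R) * k' / k R - 2 * exp ((p R)\<^sup>2) * p'))) (at R)"
proof -
  have "G u = G (p R) + k R * t" by (simp add: u_def)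
  then have t: "t = (G u - G (p R)) / k R"
    using \<open>k R \<noteq> 0\<close> by (simp add: field_simps)
  have "((\<lambda>r. m r * exp ((Ginv (G (p r) + k r * t))\<^sup>2)) has_real_derivative
     m' * exp (u\<^sup>2) + m R * (exp (u\<^sup>2) * (2 * u * (inverse (2 * exp (u\<^sup>2)) *
       (2 * exp ((p R)\<^sup>2) * p' + k' * t))))) (at R)"
    by (auto intro!: derivative_eq_intros d simp: u_def)
  also have "m R * (exp (u\<^sup>2) * (2 * u * (inverse (2 * exp (u\<^sup>2)) * (2 * exp ((p R)\<^sup>2) * p' + k' * t))))
    = u * (m R * k' / k R * G u - m R * (G (p R) * k' / k R - 2 * exp ((p R)\<^sup>2) * p'))"
    by (simp add: t) (use \<open>k R \<noteq> 0\<close> in \<open>simp add: field_simps\<close>)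
  finally show ?thesis .
qed

section \<open>Zeros of \<open>\<Gamma>\<close> as a function of U\<close>

definition h :: "real \<Rightarrow> real \<Rightarrow> real \<Rightarrow> real" where
  "h \<mu> q u = \<mu> * exp (u\<^sup>2) / u + q * G u"

text \<open>This is \<open>\<Gamma>\<close> in the variable U. Unlike \<open>h\<close> it is
  continuous across u = 0, so the intermediate value theorem can be used through
  \<open>t_star\<close>.\<close>

definition \<Phi> :: "real \<Rightarrow> real \<Rightarrow> real \<Rightarrow> real \<Rightarrow> real" where
  "\<Phi> \<mu> q s u = \<mu> * exp (u\<^sup>2) + u * (q * G u - s)"

lemma \<Phi>_eq_h: "u \<noteq> 0 \<Longrightarrow> \<Phi> \<mu> q s u = u * (h \<mu> q u - s)"
  by (simp add: \<Phi>_def h_def field_simps)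

lemma h_minus: "h \<mu> q (- u) = - h \<mu> q u"
  by (simp add: h_def G_minus)

lemma continuous_on_\<Phi>: "continuous_on S (\<Phi> \<mu> q s)"
  unfolding \<Phi>_def by (intro continuous_intros)

lemma h_deriv:
  assumes "u \<noteq> 0"
  shows "(h \<mu> q has_real_derivative exp (u\<^sup>2) * (2 * (\<mu> + q) - \<mu> / u\<^sup>2)) (at u)"
  unfolding h_def using assms
  by (auto intro!: derivative_eq_intros simp: field_simps power2_eq_square)

text \<open>For \<mu> + q > 0 and z > 0 the derivative of \<open>h\<close> has the sign of z^2 -
  \<mu> / (2 (\<mu> + q)).\<close>

lemma h_decreasing:
  assumes "0 < u" "u \<le> w" "0 < \<mu>" "0 < \<mu> + q" "w\<^sup>2 \<le> \<mu> / (2 * (\<mu> + q))"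
  shows "h \<mu> q w \<le> h \<mu> q u"
proof (rule DERIV_nonpos_imp_nonincreasing[OF \<open>u \<le> w\<close>])
  fix z assume z: "u \<le> z" "z \<le> w"
  then have "z\<^sup>2 \<le> w\<^sup>2" using assms(1) by (intro power_mono) auto
  then have "z\<^sup>2 \<le> \<mu> / (2 * (\<mu> + q))" using assms(5) by linarith
  then have "2 * (\<mu> + q) - \<mu> / z\<^sup>2 \<le> 0"
    using assms z by (simp add: field_simps)
  then show "\<exists>y. (h \<mu> q has_real_derivative y) (at z) \<and> y \<le> 0"
    using h_deriv[of z \<mu> q] assms z by (intro exI conjI) (auto intro: mult_nonneg_nonpos)
qed

lemma h_increasing:
  assumes "w \<le> u" "0 < w" "0 < \<mu>" "0 < \<mu> + q" "\<mu> / (2 * (\<mu> + q)) \<le> w\<^sup>2"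
  shows "h \<mu> q w \<le> h \<mu> q u"
proof (rule DERIV_nonneg_imp_nondecreasing[OF \<open>w \<le> u\<close>])
  fix z assume z: "w \<le> z" "z \<le> u"
  then have "w\<^sup>2 \<le> z\<^sup>2" using assms(2) by (intro power_mono) auto
  then have "\<mu> / (2 * (\<mu> + q)) \<le> z\<^sup>2" using assms(5) by linarith
  then have "0 \<le> 2 * (\<mu> + q) - \<mu> / z\<^sup>2"
    using assms z by (simp add: field_simps)
  then show "\<exists>y. (h \<mu> q has_real_derivative y) (at z) \<and> 0 \<le> y"
    using h_deriv[of z \<mu> q] assms z by (intro exI conjI) auto
qed

lemma \<Phi>_zero_between:
  assumes "\<Phi> \<mu> q s a \<le> 0 \<and> 0 \<le> \<Phi> \<mu> q s b \<or> 0 \<le> \<Phi> \<mu> q s a \<and> \<Phi> \<mu> q s b \<le> 0" "a \<le> b"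
  shows "\<exists>u. a \<le> u \<and> u \<le> b \<and> \<Phi> \<mu> q s u = 0"
  using assms IVT'[of "\<Phi> \<mu> q s" a 0 b] IVT2'[of "\<Phi> \<mu> q s" b 0 a] continuous_on_\<Phi> by blast

lemma \<Phi>_zero_if_nonpos:
  assumes "\<mu> \<le> 0" "p < 0" "0 < \<Phi> \<mu> q s p"
  shows "\<exists>u>p. \<Phi> \<mu> q s u = 0"
proof -
  have "\<Phi> \<mu> q s 0 \<le> 0" using assms by (simp add: \<Phi>_def)
  then obtain u where "p \<le> u" "\<Phi> \<mu> q s u = 0"
    using \<Phi>_zero_between[of \<mu> q s p 0] assms by auto
  then show ?thesis
    using assms by (metis order_le_less order_less_irrefl)
qed

text \<open>For \<mu> > 0 the derivative of \<open>h\<close> is -\<mu> exp(z^2) / z^2, hence at most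
  -\<mu>, so \<open>h\<close> falls at least linearly and eventually drops below
  \<open>s\<close>.\<close>

lemma \<Phi>_zero_if_degenerate:
  assumes "\<mu> + q = 0" "p < 0" "0 < \<Phi> \<mu> q s p"
  shows "\<exists>u>p. \<Phi> \<mu> q s u = 0"
proof (cases "\<mu> \<le> 0")
  case True
  then show ?thesis using \<Phi>_zero_if_nonpos assms by blast
next
  case False
  \<comment> \<open>Chosen so that \<mu> (u - 1) equals the distance from \<open>h \<mu> q 1\<close>
    to \<open>s\<close>.\<close>
  define u where "u = 1 + \<bar>h \<mu> q 1 - s\<bar> / \<mu>"
  have "1 \<le> u" using False by (simp add: u_def)
  have "h \<mu> q u + \<mu> * u \<le> h \<mu> q 1 + \<mu> * 1"
  proof (rule DERIV_nonpos_imp_nonincreasing[OF \<open>1 \<le> u\<close>])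
    fix z :: real assume z: "1 \<le> z" "z \<le> u"
    have "z\<^sup>2 \<le> exp (z\<^sup>2)"
      using exp_ge_add_one_self[of "z\<^sup>2"] by linarith
    then have "\<mu> * z\<^sup>2 \<le> \<mu> * exp (z\<^sup>2)"
      using False by simp
    then have "exp (z\<^sup>2) * (2 * (\<mu> + q) - \<mu> / z\<^sup>2) + \<mu> \<le> 0"
      using z assms(1) by (simp add: field_simps)
    moreover have "((\<lambda>z. h \<mu> q z + \<mu> * z) has_real_derivative
        exp (z\<^sup>2) * (2 * (\<mu> + q) - \<mu> / z\<^sup>2) + \<mu>) (at z)"
      using z by (auto intro!: derivative_eq_intros h_deriv)
    ultimately show "\<exists>y. ((\<lambda>z. h \<mu> q z + \<mu> * z) has_real_derivative y) (at z) \<and> y \<le> 0"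
      by blast
  qed
  then have "h \<mu> q u \<le> s"
    using False by (simp add: u_def algebra_simps)
  then have "\<Phi> \<mu> q s u \<le> 0"
    using \<open>1 \<le> u\<close> by (simp add: \<Phi>_eq_h mult_nonneg_nonpos)
  then obtain z where "p \<le> z" "\<Phi> \<mu> q s z = 0"
    using \<Phi>_zero_between[of \<mu> q s p u] assms \<open>1 \<le> u\<close> by auto
  then show ?thesis
    using assms by (metis order_le_less order_less_irrefl)
qed

text \<open>A positive zero solves h(u) = s, where \<open>w\<close> is the minimum of
  \<open>h\<close>. A negative one solves h(-u) = -s with -u < -p. Positivity at \<open>p\<close>
  means h(-p) > -s, so if w >= -p, then \<open>h\<close> decreases on (0, -p] and exceeds -s there.
  Conversely, \<Phi>(0) = \<mu> > 0 and the intermediate value theorem applies between 0 and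
  \<open>w\<close> or \<open>- w\<close>.\<close>

lemma \<Phi>_zero_iff:
  assumes "0 < \<mu>" "0 < \<mu> + q" "0 < w" "w\<^sup>2 = \<mu> / (2 * (\<mu> + q))" "p < 0" "0 < \<Phi> \<mu> q s p"
  shows "(\<exists>u>p. \<Phi> \<mu> q s u = 0) \<longleftrightarrow> h \<mu> q w \<le> s \<or> w < - p \<and> h \<mu> q w \<le> - s"
proof
  assume "\<exists>u>p. \<Phi> \<mu> q s u = 0"
  then obtain u where u: "u > p" "\<Phi> \<mu> q s u = 0" by blast
  have "u \<noteq> 0" using u(2) assms by (auto simp: \<Phi>_def)
  then have hu: "h \<mu> q u = s" using u by (simp add: \<Phi>_eq_h)
  consider "0 < u" | "u < 0" using \<open>u \<noteq> 0\<close> by linarith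
  then show "h \<mu> q w \<le> s \<or> w < - p \<and> h \<mu> q w \<le> - s"
  proof cases
    case 1
    then show ?thesis
      using h_decreasing[of u w \<mu> q] h_increasing[of w u \<mu> q] assms hu by linarith
  next
    case 2
    have hu': "h \<mu> q (- u) = - s" using hu by (simp add: h_minus)
    have "p * (h \<mu> q p - s) > 0" using assms by (simp add: \<Phi>_eq_h)
    then have "h \<mu> q p < s" using \<open>p < 0\<close> by (simp add: zero_less_mult_iff)
    then have hp: "h \<mu> q (- p) > - s" by (simp add: h_minus)
    have "w < - p"
    proof (rule ccontr)
      assume "\<not> w < - p"
      have "h \<mu> q (- p) \<le> h \<mu> q (- u)"
      proof (rule h_decreasing)
        have "(- p)\<^sup>2 \<le> w\<^sup>2"
          using \<open>\<not> w < - p\<close> \<open>p < 0\<close> by (intro power_mono) auto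
        then show "(- p)\<^sup>2 \<le> \<mu> / (2 * (\<mu> + q))" using assms by simp
      qed (use 2 u assms in auto)
      then show False using hu' hp by simp
    qed
    moreover have "h \<mu> q w \<le> - s"
      using h_decreasing[of "- u" w \<mu> q] h_increasing[of w "- u" \<mu> q] assms hu' 2 by linarith
    ultimately show ?thesis by blast
  qed
next
  have 0: "0 < \<Phi> \<mu> q s 0" using assms by (simp add: \<Phi>_def)
  assume "h \<mu> q w \<le> s \<or> w < - p \<and> h \<mu> q w \<le> - s"
  then show "\<exists>u>p. \<Phi> \<mu> q s u = 0"
  proof
    assume "h \<mu> q w \<le> s"
    then have "\<Phi> \<mu> q s w \<le> 0"
      using \<open>0 < w\<close> by (simp add: \<Phi>_eq_h mult_nonneg_nonpos)
    then obtain u where "0 \<le> u" "\<Phi> \<mu> q s u = 0"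
      using \<Phi>_zero_between[of \<mu> q s 0 w] 0 \<open>0 < w\<close> by auto
    then show ?thesis using \<open>p < 0\<close> by (meson less_le_trans)
  next
    assume *: "w < - p \<and> h \<mu> q w \<le> - s"
    then have "h \<mu> q (- w) - s \<ge> 0" by (simp add: h_minus)
    then have "\<Phi> \<mu> q s (- w) \<le> 0"
      using \<open>0 < w\<close> by (simp add: \<Phi>_eq_h)
    then obtain u where "- w \<le> u" "\<Phi> \<mu> q s u = 0"
      using \<Phi>_zero_between[of \<mu> q s "- w" 0] 0 \<open>0 < w\<close> by auto
    then show ?thesis using * by (intro exI[of _ u]) auto
  qed
qed

section \<open>The integral in the breakdown conditions\<close>

lemma powr_three_halves: "0 < x \<Longrightarrow> x powr (3 / 2) = x * sqrt x" for x :: real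
  using powr_add[of x 1 "1/2"] by (simp add: powr_half_sqrt)

text \<open>Since X = m exp(U^2) with m = exp(-c/a), the expression
  \<open>sqrt (ln y + c / a)\<close> is the absolute value of U at X = y. In this variable the
  integrand is the derivative of 2 h / sqrt a. Both limits exceed \<open>m\<close>, so the
  denominator stays positive for either orientation.\<close>

lemma interval_integral_h:
  fixes a a' c c' \<mu> q :: real
  assumes "0 < a" and b: "exp (- (c / a)) < b" "exp (- (c / a)) < b'"
    and \<mu>: "\<mu> = exp (- (c / a)) * (c * a' / a\<^sup>2 - c' / a)"
    and q: "\<mu> + q = exp (- (c / a)) * a' / (2 * a)"
  shows "(LBINT y=ereal b..ereal b'. (c' + a' * ln y) / (c + a * ln y) powr (3 / 2)) =
    2 * (h \<mu> q (sqrt (ln b' + c / a)) - h \<mu> q (sqrt (ln b + c / a))) / sqrt a"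
proof -
  have y: "0 < y \<and> 0 < ln y + c / a \<and> 0 < c + a * ln y" if "min b b' \<le> y" for y
  proof -
    have "exp (- (c / a)) < y" using b that by auto
    then have "0 < y" by (meson exp_gt_zero less_trans)
    moreover from this \<open>exp (- (c / a)) < y\<close> have "- (c / a) < ln y"
      using ln_ge_iff not_le by (metis exp_gt_zero ln_exp ln_less_cancel_iff)
    ultimately show ?thesis
      using \<open>0 < a\<close> by (simp add: field_simps)
  qed
  have "(LBINT y=ereal b..ereal b'. (c' + a' * ln y) / (c + a * ln y) powr (3 / 2)) =
    2 * h \<mu> q (sqrt (ln b' + c / a)) / sqrt a - 2 * h \<mu> q (sqrt (ln b + c / a)) / sqrt a"
  proof (rule interval_integral_FTC_finite)
    show "continuous_on {min b b'..max b b'} (\<lambda>y. (c' + a' * ln y) / (c + a * ln y) powr (3 / 2))"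
      using y by (intro continuous_intros) (force simp: less_le)+
    fix y assume "min b b' \<le> y" "y \<le> max b b'"
    then have y: "0 < y" "0 < ln y + c / a" "0 < c + a * ln y" using y by auto
    define w where "w = ln y + c / a"
    have w: "0 < w" "c + a * ln y = a * w" using y \<open>0 < a\<close> by (auto simp: w_def field_simps)
    have ew: "exp w = y / exp (- (c / a))"
      using y by (simp add: w_def exp_add exp_minus field_simps)
    have q': "2 * (\<mu> + q) = exp (- (c / a)) * a' / a" by (simp add: q)
    have "((\<lambda>y. sqrt (ln y + c / a)) has_real_derivative inverse (sqrt w) / 2 * (1 / y)) (at y)"
      using y unfolding w_def by (auto intro!: derivative_eq_intros)
    then have "((\<lambda>y. 2 * h \<mu> q (sqrt (ln y + c / a)) / sqrt a) has_real_derivative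
      2 * (exp ((sqrt w)\<^sup>2) * (2 * (\<mu> + q) - \<mu> / (sqrt w)\<^sup>2) * (inverse (sqrt w) / 2 * (1 / y))) / sqrt a) (at y)"
      using w(1) unfolding w_def
      by (intro DERIV_cdivide DERIV_cmult DERIV_chain2[OF h_deriv]) auto
    also have "2 * (exp ((sqrt w)\<^sup>2) * (2 * (\<mu> + q) - \<mu> / (sqrt w)\<^sup>2) * (inverse (sqrt w) / 2 * (1 / y))) / sqrt a
      = (a' / a - (c * a' / a\<^sup>2 - c' / a) / w) / (sqrt w * sqrt a)"
      unfolding q' unfolding \<mu> using w y \<open>0 < a\<close> by (simp add: ew field_simps)
    also have "\<dots> = (a' * w - c * a' / a + c') / (a * w * (sqrt w * sqrt a))"
      using w y \<open>0 < a\<close> by (simp add: field_simps power2_eq_square)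
    also have "\<dots> = (c' + a' * ln y) / (c + a * ln y) powr (3 / 2)"
    proof -
      have "a' * w - c * a' / a + c' = c' + a' * ln y"
        using \<open>0 < a\<close> by (simp add: w_def field_simps)
      then show ?thesis
        unfolding w(2) using w(1) \<open>0 < a\<close> by (simp add: powr_three_halves real_sqrt_mult ac_simps)
    qed
    finally show "((\<lambda>y. 2 * h \<mu> q (sqrt (ln y + c / a)) / sqrt a) has_vector_derivative
        (c' + a' * ln y) / (c + a * ln y) powr (3 / 2)) (at y within {min b b'..max b b'})"
      by (simp add: has_real_derivative_iff_has_vector_derivative[symmetric] has_field_derivative_at_within)
  qed
  then show ?thesis by (simp add: diff_divide_distrib right_diff_distrib)
qed

section \<open>Derivatives of the data and \<open>t_star\<close>\<close>

lemma m0_deriv: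
  assumes "continuous_on {0..} \<rho>" "0 < R"
  shows "(m0 \<rho> has_real_derivative \<rho> R * R) (at R)"
proof -
  have "((\<lambda>r. integral {0..r} (\<lambda>s. \<rho> s * s)) has_real_derivative \<rho> R * R) (at R within {0..R + 1})"
    by (rule integral_has_real_derivative)
      (use assms in \<open>auto intro!: continuous_intros continuous_on_subset[OF assms(1)]\<close>)
  moreover have "at R within {0..R + 1} = at R"
    using assms(2) by (intro at_within_interior) auto
  ultimately show ?thesis by (simp add: m0_def[abs_def])
qed

lemma m0_nonneg:
  assumes "\<And>s. 0 \<le> s \<Longrightarrow> 0 \<le> \<rho> s"
  shows "0 \<le> m0 \<rho> r"
\<comment> \<open>The integral of a non-integrable function is 0 by default.\<close>
proof (cases "(\<lambda>s. \<rho> s * s) integrable_on {0..r}")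
  case True
  then show ?thesis
    unfolding m0_def by (rule integral_nonneg) (use assms in auto)
qed (simp add: m0_def not_integrable_integral)

text \<open>As \<open>v r\<close> is negative, the upper limit of the integral is exp((-p)^2) with
  -p > 0; oddness of \<open>G\<close> then yields -G(p) / k.\<close>

lemma t_star_eq:
  assumes "0 < A_fun lam \<rho> r" "v r < 0"
  shows "t_star lam \<rho> v r = - (r * exp (- ((v r)\<^sup>2 / A_fun lam \<rho> r)) / sqrt (A_fun lam \<rho> r) *
    G (v r / sqrt (A_fun lam \<rho> r)))"
proof -
  define p where "p = v r / sqrt (A_fun lam \<rho> r)"
  have "p < 0" using assms by (simp add: p_def divide_neg_pos)
  have p2: "(v r)\<^sup>2 / A_fun lam \<rho> r = (- p)\<^sup>2"
    using assms by (simp add: p_def power_divide)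
  show ?thesis
    unfolding t_star_def p2 p_def[symmetric]
    by (subst integral_inverse_sqrt_ln) (use \<open>p < 0\<close> in \<open>auto simp: G_minus exp_minus field_simps\<close>)
qed

lemma DERIV_eventually_eq:
  assumes "(g has_real_derivative D) (at x)" "eventually (\<lambda>y. f y = g y) (nhds x)"
  shows "(f has_real_derivative D) (at x)"
  using assms DERIV_cong_ev[OF refl assms(2) refl] by simp

lemma C1_has_real_derivative:
  fixes v :: "real \<Rightarrow> real"
  assumes "v C1_differentiable_on S" "x \<in> S"
  shows "\<exists>D. (v has_real_derivative D) (at x)"
  using assms unfolding C1_differentiable_on_def
  by (auto simp: has_real_derivative_iff_has_vector_derivative)

section \<open>The breakdown criterion\<close>

theorem proposition1p15:
  fixes lam R :: real
    and \<rho>\<^sub>0 v\<^sub>0 :: "real \<Rightarrow> real"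
    and X :: "real \<Rightarrow> real \<Rightarrow> real"
  assumes "continuous_on {0..} \<rho>\<^sub>0"
    and "\<And>r. 0 \<le> r \<Longrightarrow> 0 \<le> \<rho>\<^sub>0 r"
    and "continuous_on {0..} v\<^sub>0"
    and "v\<^sub>0 C1_differentiable_on {0<..}"
    and "v\<^sub>0 0 = 0"
    and "lam < 0"
    and "\<And>r. 0 < r \<Longrightarrow> is_characteristic lam \<rho>\<^sub>0 v\<^sub>0 r (\<lambda>t. X t r)"
    and "0 < R"
    and "v\<^sub>0 R < 0"
  shows "(\<exists>tc>0. tc \<in> lifespan (\<lambda>t. X t R) \<and> (X tc R = 0 \<or> Gamma_flow X tc R = 0)) \<longleftrightarrow>
    A_fun lam \<rho>\<^sub>0 R = 0 \<or>
    \<rho>\<^sub>0 R = 0 \<or>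
    (deriv (A_fun lam \<rho>\<^sub>0) R > 0 \<and>
      (deriv (\<lambda>r. (v\<^sub>0 r)\<^sup>2) R \<ge>
         A_fun lam \<rho>\<^sub>0 R / R + deriv (A_fun lam \<rho>\<^sub>0) R *
           ln (R * exp (C_fun lam \<rho>\<^sub>0 v\<^sub>0 R / A_fun lam \<rho>\<^sub>0 R))
       \<or>
       (A_fun lam \<rho>\<^sub>0 R / R \<le> deriv (\<lambda>r. (v\<^sub>0 r)\<^sup>2) R \<and>
        deriv (\<lambda>r. (v\<^sub>0 r)\<^sup>2) R <
          A_fun lam \<rho>\<^sub>0 R / R + deriv (A_fun lam \<rho>\<^sub>0) R *
            ln (R * exp (C_fun lam \<rho>\<^sub>0 v\<^sub>0 R / A_fun lam \<rho>\<^sub>0 R)) \<and>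
        I_fun lam \<rho>\<^sub>0 v\<^sub>0 R \<le> max 0 (2 * deriv (t_star lam \<rho>\<^sub>0 v\<^sub>0) R))
       \<or>
       (deriv (\<lambda>r. (v\<^sub>0 r)\<^sup>2) R < A_fun lam \<rho>\<^sub>0 R / R \<and>
        I_fun lam \<rho>\<^sub>0 v\<^sub>0 R \<le> 2 * deriv (t_star lam \<rho>\<^sub>0 v\<^sub>0) R)))"
    (is "?L \<longleftrightarrow> ?R")
proof (cases "A_fun lam \<rho>\<^sub>0 R = 0")
  case True
  then have "m0 \<rho>\<^sub>0 R = 0" using \<open>lam < 0\<close> by (simp add: A_fun_def)
  then have ?L
    using characteristic_free[OF assms(7)[OF \<open>0 < R\<close>]] assms(8,9) by blast
  with True show ?thesis by blast
next
  case False
  define A where "A = A_fun lam \<rho>\<^sub>0"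
  define C where "C = C_fun lam \<rho>\<^sub>0 v\<^sub>0"
  define a where "a = A R"
  define a' where "a' = 2 * \<bar>lam\<bar> * (\<rho>\<^sub>0 R * R)"
  define c where "c = C R"
  have "0 \<le> A R"
    using m0_nonneg[of \<rho>\<^sub>0 R] assms(2) by (simp add: A_def A_fun_def)
  then have "0 < a" using False by (simp add: A_def a_def)
  have dA [derivative_intros]: "(A has_real_derivative a') (at R)"
    unfolding A_def A_fun_def[abs_def] a'_def using m0_deriv[OF assms(1,8)] by (rule DERIV_cmult)
  obtain v' where dv [derivative_intros]: "(v\<^sub>0 has_real_derivative v') (at R)"
    using C1_has_real_derivative[OF assms(4)] \<open>0 < R\<close> by auto
  define V where "V = 2 * v\<^sub>0 R * v'"
  define c' where "c' = V - a' * ln R - a / R"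
  have dV: "((\<lambda>r. (v\<^sub>0 r)\<^sup>2) has_real_derivative V) (at R)"
    unfolding V_def by (auto intro!: derivative_eq_intros)
  have dC [derivative_intros]: "(C has_real_derivative c') (at R)"
    unfolding C_def C_fun_def[abs_def] A_def[symmetric] c'_def a_def
    using dV \<open>0 < R\<close> by (auto intro!: derivative_eq_intros simp: V_def)
  have c: "c = (v\<^sub>0 R)\<^sup>2 - a * ln R"
    by (simp add: c_def C_def C_fun_def a_def A_def)
  \<comment> \<open>The closed formulas for \<open>X\<close>, \<open>m\<close> and
    \<open>t_star\<close> need these signs, and differentiating them at \<open>R\<close> needs the
    formulas in a neighbourhood.\<close>
  have "eventually (\<lambda>r. 0 < A r) (nhds R)"
    using order_tendstoD(1)[OF isCont_tendsto_compose[OF DERIV_isCont[OF dA] filterlim_ident], of 0] \<open>0 < a\<close>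
    by (auto simp: a_def)
  moreover have "eventually (\<lambda>r. v\<^sub>0 r < 0) (nhds R)"
    using order_tendstoD(2)[OF isCont_tendsto_compose[OF DERIV_isCont[OF dv] filterlim_ident], of 0] assms(9)
    by auto
  moreover have "eventually (\<lambda>r. 0 < r) (nhds R)"
    using order_tendstoD(1)[OF filterlim_ident[of "nhds R"], of 0] assms(8) by auto
  ultimately have ev: "eventually (\<lambda>r. 0 < A r \<and> v\<^sub>0 r < 0 \<and> 0 < r) (nhds R)"
    by eventually_elim auto

  define m where "m r = r * exp (- ((v\<^sub>0 r)\<^sup>2 / A r))" for r
  define k where "k r = sqrt (A r) / m r" for r
  define p where "p r = v\<^sub>0 r / sqrt (A r)" for r
  define \<mu> where "\<mu> = exp (- (c / a)) * (c * a' / a\<^sup>2 - c' / a)"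
  \<comment> \<open>In this form the derivative of \<open>m\<close> is expressed by the derivatives
    of \<open>A\<close> and \<open>C\<close>, as the integrand requires.\<close>
  have m_eq: "m r = exp (- (C r / A r))" if "0 < A r" "0 < r" for r
  proof -
    have "- (C r / A r) = ln r + - ((v\<^sub>0 r)\<^sup>2 / A r)"
      using that(1) by (simp add: C_def C_fun_def A_def[symmetric] diff_divide_distrib)
    then have "exp (- (C r / A r)) = exp (ln r) * exp (- ((v\<^sub>0 r)\<^sup>2 / A r))"
      by (simp only: exp_add)
    then show ?thesis using that(2) by (simp add: m_def)
  qed
  have "((\<lambda>r. exp (- (C r / A r))) has_real_derivative \<mu>) (at R)"
    unfolding \<mu>_def using \<open>0 < a\<close>
    by (auto intro!: derivative_eq_intros simp: a_def c_def field_simps power2_eq_square)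
  moreover have "eventually (\<lambda>r. m r = exp (- (C r / A r))) (nhds R)"
    using ev by eventually_elim (auto intro: m_eq)
  ultimately have dm [derivative_intros]: "(m has_real_derivative \<mu>) (at R)"
    by (rule DERIV_eventually_eq)
  have mR: "m R = exp (- (c / a))"
    using m_eq[of R] \<open>0 < a\<close> \<open>0 < R\<close> by (simp add: a_def c_def)
  have "0 < m R" by (simp add: mR)
  define p' where "p' = (v' * sqrt a - v\<^sub>0 R * (a' / (2 * sqrt a))) / a"
  have dp [derivative_intros]: "(p has_real_derivative p') (at R)"
    unfolding p_def[abs_def] p'_def using \<open>0 < a\<close>
    by (auto intro!: derivative_eq_intros simp: a_def field_simps)
  define k' where "k' = (a' / (2 * sqrt a) * m R - sqrt a * \<mu>) / (m R)\<^sup>2"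
  have dk [derivative_intros]: "(k has_real_derivative k') (at R)"
    unfolding k_def[abs_def] k'_def using \<open>0 < a\<close> \<open>0 < m R\<close>
    by (auto intro!: derivative_eq_intros simp: a_def field_simps power2_eq_square)
  have "0 < k R" using \<open>0 < a\<close> \<open>0 < m R\<close> by (simp add: k_def a_def)
  define q where "q = m R * k' / k R"
  \<comment> \<open>The logarithmic derivative of k = sqrt A / m is a' / (2 a) - \<mu> / m. Hence
    \<mu> + q vanishes exactly when \<open>a'\<close> does.\<close>
  have q: "\<mu> + q = exp (- (c / a)) * a' / (2 * a)"
    using \<open>0 < a\<close> \<open>0 < m R\<close> unfolding mR[symmetric] q_def k'_def k_def a_def[symmetric]
    by (simp add: field_simps power2_eq_square)
  define s where "s = m R * (G (p R) * k' / k R - 2 * exp ((p R)\<^sup>2) * p')"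
  have "p R < 0" using \<open>0 < a\<close> assms(9) by (simp add: p_def a_def divide_neg_pos)

  have Xr: "lifespan (\<lambda>t. X t r) = {0..}"
     "0 \<le> t \<Longrightarrow> X t r = m r * exp ((Ginv (G (p r) + k r * t))\<^sup>2)" "0 \<le> t \<Longrightarrow> 0 < X t r"
     if "0 < A r" "0 < r" for r t
    using characteristic_explicit[OF assms(7) \<open>lam < 0\<close> that(2) _ that(1) m_def, OF that(2) A_def[THEN fun_cong]]
    unfolding k_def p_def by auto
  have flow: "((\<lambda>r. X t r) has_real_derivative \<Phi> \<mu> q s (Ginv (G (p R) + k R * t))) (at R)" if "0 \<le> t" for t
  proof -
    have "eventually (\<lambda>r. X t r = m r * exp ((Ginv (G (p r) + k r * t))\<^sup>2)) (nhds R)"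
      using ev by eventually_elim (auto intro: Xr that)
    moreover have "((\<lambda>r. m r * exp ((Ginv (G (p r) + k r * t))\<^sup>2)) has_real_derivative
        \<Phi> \<mu> q s (Ginv (G (p R) + k R * t))) (at R)"
      using explicit_flow_deriv[OF dm dk dp, of t] \<open>0 < k R\<close> unfolding \<Phi>_def q_def s_def by simp
    ultimately show ?thesis
      by (rule DERIV_eventually_eq[rotated])
  qed
  then have Gam: "Gamma_flow X t R = \<Phi> \<mu> q s (Ginv (G (p R) + k R * t))" if "0 \<le> t" for t
    unfolding Gamma_flow_def using that by (intro DERIV_imp_deriv)
  have X0: "X 0 r = r" if "0 < r" for r
    using assms(7)[OF that] by (simp add: is_characteristic_def)
  have "eventually (\<lambda>r. X 0 r = r) (nhds R)"
    using ev by eventually_elim (auto intro: X0)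
  then have "((\<lambda>r. X 0 r) has_real_derivative 1) (at R)"
    by (rule DERIV_eventually_eq[OF DERIV_ident])
  \<comment> \<open>At time 0 the flow is the identity near \<open>R\<close>, so
    \<open>\<Gamma>\<close> starts at 1.\<close>
  then have \<Phi>p: "\<Phi> \<mu> q s (p R) = 1"
    using flow[of 0] DERIV_unique by fastforce
  \<comment> \<open>\<open>X\<close> stays positive, so only \<open>\<Gamma>\<close> can vanish; U
    increases with time and maps the positive times onto all values above
    \<open>p R\<close>.\<close>
  have L: "?L \<longleftrightarrow> (\<exists>u>p R. \<Phi> \<mu> q s u = 0)"
  proof
    assume ?L
    then obtain t where "0 < t" "X t R = 0 \<or> Gamma_flow X t R = 0" by blast
    moreover have "0 < X t R"
      using Xr(3)[of R t] \<open>0 < t\<close> \<open>0 < a\<close> \<open>0 < R\<close> by (simp add: a_def)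
    ultimately have "\<Phi> \<mu> q s (Ginv (G (p R) + k R * t)) = 0" using Gam by force
    moreover have "G (p R) < G (Ginv (G (p R) + k R * t))"
      using \<open>0 < t\<close> \<open>0 < k R\<close> by simp
    then have "p R < Ginv (G (p R) + k R * t)"
      using G_strict_mono strict_mono_less by blast
    ultimately show "\<exists>u>p R. \<Phi> \<mu> q s u = 0" by blast
  next
    assume "\<exists>u>p R. \<Phi> \<mu> q s u = 0"
    then obtain u where u: "u > p R" "\<Phi> \<mu> q s u = 0" by blast
    define t where "t = (G u - G (p R)) / k R"
    have "0 < t"
      using u(1) G_strict_mono \<open>0 < k R\<close> by (simp add: t_def strict_mono_less)
    moreover have "G (p R) + k R * t = G u"
      using \<open>0 < k R\<close> by (simp add: t_def)
    then have "Gamma_flow X t R = 0"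
      using Gam[of t] \<open>0 < t\<close> u(2) by simp
    moreover have "t \<in> lifespan (\<lambda>t. X t R)"
      using Xr(1)[of R] \<open>0 < t\<close> \<open>0 < a\<close> \<open>0 < R\<close> by (simp add: a_def)
    ultimately show ?L by blast
  qed

  have dts: "deriv (t_star lam \<rho>\<^sub>0 v\<^sub>0) R = s / sqrt a"
  proof (rule DERIV_imp_deriv)
    have "((\<lambda>r. - (G (p r) / k r)) has_real_derivative
        - ((2 * exp ((p R)\<^sup>2) * p' * k R - G (p R) * k') / (k R * k R))) (at R)"
      using \<open>0 < k R\<close> by (intro DERIV_minus DERIV_divide DERIV_chain2[OF G_deriv] dp dk) auto
    moreover have "- ((2 * exp ((p R)\<^sup>2) * p' * k R - G (p R) * k') / (k R * k R)) = s / sqrt a"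
    proof -
      have sq: "sqrt a = k R * m R" using \<open>0 < m R\<close> by (simp add: k_def a_def)
      show ?thesis unfolding sq s_def using \<open>0 < m R\<close> \<open>0 < k R\<close> by (simp add: field_simps)
    qed
    moreover have "eventually (\<lambda>r. t_star lam \<rho>\<^sub>0 v\<^sub>0 r = - (G (p r) / k r)) (nhds R)"
      using ev by eventually_elim (auto simp: t_star_eq A_def k_def m_def p_def)
    ultimately show "(t_star lam \<rho>\<^sub>0 v\<^sub>0 has_real_derivative s / sqrt a) (at R)"
      by (simp add: DERIV_eventually_eq)
  qed
  have derivs: "deriv A R = a'" "deriv C R = c'" "deriv (\<lambda>r. (v\<^sub>0 r)\<^sup>2) R = V"
    using dA dC dV by (auto intro: DERIV_imp_deriv)
  have ln_eq: "ln (R * exp (c / a)) = ln R + c / a"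
    using \<open>0 < R\<close> by (simp add: ln_mult)
  have "0 \<le> a'" using assms(2)[of R] \<open>0 < R\<close> by (simp add: a'_def)
  have a'_0: "a' = 0 \<longleftrightarrow> \<rho>\<^sub>0 R = 0" using \<open>0 < R\<close> \<open>lam < 0\<close> by (simp add: a'_def)
  have \<mu>_iff: "\<mu> \<le> 0 \<longleftrightarrow> a / R + a' * (ln R + c / a) \<le> V"
  proof -
    have "\<mu> \<le> 0 \<longleftrightarrow> c * a' / a\<^sup>2 - c' / a \<le> 0"
      by (simp add: \<mu>_def mult_le_0_iff)
    also have "\<dots> \<longleftrightarrow> c * a' / a \<le> c'"
      using \<open>0 < a\<close> by (simp add: field_simps power2_eq_square)
    also have "\<dots> \<longleftrightarrow> a / R + a' * (ln R + c / a) \<le> V"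
      unfolding c'_def by (simp add: algebra_simps)
    finally show ?thesis .
  qed
  show ?thesis
  proof (cases "a' = 0 \<or> \<mu> \<le> 0")
    case True
    then have ?R
    proof
      assume "\<mu> \<le> 0"
      then show ?R
        using \<mu>_iff a'_0 \<open>0 \<le> a'\<close> unfolding A_def[symmetric] C_def[symmetric] derivs
          a_def[symmetric] c_def[symmetric] ln_eq by auto
    qed (use a'_0 in blast)
    moreover have "\<exists>u>p R. \<Phi> \<mu> q s u = 0"
      using True \<Phi>_zero_if_nonpos[of \<mu> "p R" q s] \<Phi>_zero_if_degenerate[of \<mu> q "p R" s]
        \<open>p R < 0\<close> \<Phi>p q by auto
    ultimately show ?thesis using L by blast
  next
    case False
    then have "0 < a'" "0 < \<mu>" using \<open>0 \<le> a'\<close> by auto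
    \<comment> \<open>This is the value of U on the outgoing branch at X = exp(-c'/a'), the upper
      limit of the integral.\<close>
    define w where "w = sqrt (c / a - c' / a')"
    have "0 < \<mu> + q" using \<open>0 < a'\<close> \<open>0 < a\<close> by (simp add: q)
    have w2: "\<mu> / (2 * (\<mu> + q)) = c / a - c' / a'"
      unfolding q unfolding \<mu>_def using \<open>0 < a'\<close> \<open>0 < a\<close> by (simp add: field_simps power2_eq_square)
    then have w_pos: "0 < c / a - c' / a'"
      using \<open>0 < \<mu>\<close> \<open>0 < \<mu> + q\<close> by (metis divide_pos_pos mult_pos_pos zero_less_numeral)
    then have w: "0 < w" "w\<^sup>2 = \<mu> / (2 * (\<mu> + q))"
      unfolding w2 using w_pos by (auto simp: w_def)
    have lnR: "ln R + c / a = (p R)\<^sup>2"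
      using \<open>0 < a\<close> by (simp add: c p_def a_def[symmetric] power_divide field_simps)
    have sqrt_lnR: "sqrt (ln R + c / a) = - p R"
      using \<open>p R < 0\<close> by (simp add: lnR)
    have "- (c / a) < ln R"
      using lnR \<open>p R < 0\<close> by (smt (verit) zero_less_power2)
    then have bR: "exp (- (c / a)) < R"
      using \<open>0 < R\<close> by (metis exp_less_cancel_iff exp_ln)
    define y where "y = exp (- (c' / a'))"
    have by_: "exp (- (c / a)) < y" using w_pos by (simp add: y_def)
    have lny: "sqrt (ln y + c / a) = w" by (simp add: y_def w_def)
    \<comment> \<open>The initial value of \<open>\<Gamma>\<close> rewrites 1 / |v0| through h(-p),
      which then cancels the contribution of the lower limit \<open>R\<close> of the
      integral.\<close>
    have "p R * (h \<mu> q (p R) - s) = 1"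
      using \<Phi>p \<open>p R < 0\<close> by (simp add: \<Phi>_eq_h)
    then have hp1: "- p R * (h \<mu> q (- p R) + s) = 1"
      unfolding h_minus by (simp add: algebra_simps)
    then have hp: "1 / \<bar>v\<^sub>0 R\<bar> = (h \<mu> q (- p R) + s) / sqrt a"
      using \<open>0 < a\<close> assms(9) by (simp add: p_def a_def[symmetric] field_simps)
    have hp_pos: "- s < h \<mu> q (- p R)"
      using hp1 \<open>p R < 0\<close> by (smt (verit) mult_nonneg_nonpos)
    have I: "I_fun lam \<rho>\<^sub>0 v\<^sub>0 R = (h \<mu> q w + s) / sqrt a"
      unfolding I_fun_def A_def[symmetric] C_def[symmetric] derivs a_def[symmetric] c_def[symmetric]
        y_def[symmetric] interval_integral_h[OF \<open>0 < a\<close> bR by_ \<mu>_def q] sqrt_lnR lny hp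
      using \<open>0 < a\<close> by (simp add: field_simps)
    have I0: "I_fun lam \<rho>\<^sub>0 v\<^sub>0 R \<le> 0 \<longleftrightarrow> h \<mu> q w \<le> - s"
      unfolding I using \<open>0 < a\<close> by (auto simp: field_simps)
    have I2: "I_fun lam \<rho>\<^sub>0 v\<^sub>0 R \<le> 2 * deriv (t_star lam \<rho>\<^sub>0 v\<^sub>0) R \<longleftrightarrow> h \<mu> q w \<le> s"
      unfolding I dts using \<open>0 < a\<close> by (simp add: field_simps)
    have "a' * (ln R + c / a - (c / a - c' / a')) = c' + a' * ln R"
      using \<open>0 < a'\<close> by (simp add: field_simps)
    then have V: "V - a / R = a' * ((p R)\<^sup>2 - w\<^sup>2)"
      unfolding lnR[symmetric] w(2) w2 by (simp add: c'_def)
    \<comment> \<open>The sign of V - a/R decides whether the critical radius is already passed on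
      the way in, before \<open>t_star\<close>.\<close>
    have wp: "w < - p R \<longleftrightarrow> a / R < V"
    proof -
      have "w < - p R \<longleftrightarrow> w\<^sup>2 < (- p R)\<^sup>2"
        using w(1) \<open>p R < 0\<close> power2_less_imp_less[of w "- p R"] power_strict_mono[of w "- p R" 2]
        by auto
      also have "\<dots> \<longleftrightarrow> 0 < V - a / R"
        unfolding V using \<open>0 < a'\<close> by (simp add: zero_less_mult_iff)
      finally show ?thesis by simp
    qed
    \<comment> \<open>Condition (b) includes equality while the criterion for zeros is strict. At
      equality w = -p, and there h > -s, so both versions agree.\<close>
    have eqw: "h \<mu> q w > - s" if "V = a / R"
    proof -
      have "w\<^sup>2 = (- p R)\<^sup>2" using V that \<open>0 < a'\<close> by simp
      then have "w = - p R" by (rule power2_eq_imp_eq) (use w(1) \<open>p R < 0\<close> in auto)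
      then show ?thesis using hp_pos by simp
    qed
    have strict: "a / R < V \<and> h \<mu> q w \<le> - s \<longleftrightarrow> a / R \<le> V \<and> h \<mu> q w \<le> - s"
      using eqw by fastforce
    have "?L \<longleftrightarrow> h \<mu> q w \<le> s \<or> a / R < V \<and> h \<mu> q w \<le> - s"
      unfolding L wp[symmetric]
      by (rule \<Phi>_zero_iff[OF \<open>0 < \<mu>\<close> \<open>0 < \<mu> + q\<close> w \<open>p R < 0\<close>]) (simp add: \<Phi>p)
    \<comment> \<open>Being below the maximum in (b) means that one of the two inequalities
      \<open>I0\<close>, \<open>I2\<close> holds: a zero before or after \<open>t_star\<close>. In
      (c) only the later one is possible, and (a) is excluded by \<mu> > 0.\<close>
    also have "\<dots> \<longleftrightarrow> ?R"
      using \<mu>_iff I0 I2 strict \<open>0 < \<mu>\<close> \<open>0 < a'\<close> \<open>0 < a\<close> a'_0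
      unfolding A_def[symmetric] C_def[symmetric] derivs
        a_def[symmetric] c_def[symmetric] ln_eq le_max_iff_disj by auto
    finally show ?thesis .
  qed
qed

end
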